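(* Let $T\in\mathcal{BC}^{0,1}(V_5)$. For all $p,s\in\rho_S(T)$ with $s\notin[p]$, the following two equations hold: \begin{align*} &S_R^{-1}(s,\overline{T})S_{D\Delta,L}^{-1}(p,T)+S_{D\Delta,R}^{-1}(s,T)S_L^{-1}(p,\overline{T})+\tfrac12S_{D,R}^{-1}(s,T)S_{\Delta,L}^{-1}(p,T)+\tfrac12S_{\Delta,R}^{-1}(s,T)S_{D,L}^{-1}(p,T)\\ &\quad=\Big[\big(S^{-1}_{D\Delta,L}(s,T)-S^{-1}_{D\Delta,R}(p,T)\big)p-\bar{s}\big(S^{-1}_{D\Delta,L}(s,T)-S^{-1}_{D\Delta,R}(p,T)\big)\Big]Q_s^{-1}(p), \end{align*} and \begin{align*} &S_R^{-1}(s,T)S_{D\Delta,L}^{-1}(p,T)+S_{D\Delta,R}^{-1}(s,T)S_L^{-1}(p,T)+\tfrac12S_{D,R}^{-1}(s,T)S_{\Delta,L}^{-1}(p,\overline{T})+\tfrac12S_{\Delta,R}^{-1}(s,\overline{T})S_{D,L}^{-1}(p,T)\\ &\quad=\Big[\big(S^{-1}_{D\Delta,L}(s,T)-S^{-1}_{D\Delta,R}(p,T)\big)p-\bar{s}\big(S^{-1}_{D\Delta,L}(s,T)-S^{-1}_{D\Delta,R}(p,T)\big)\Big]Q_s^{-1}(p). \end{align*}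
   Context: $\mathbb{R}_5$ is the real Clifford algebra with imaginary units $e_1,\dots,e_5$, $e_\ell e_m+e_me_\ell=0$ for $\ell\ne m$, $e_\ell^2=-1$. A point of $\mathbb{R}^{6}$ is identified with the paravector $x=x_0+\underline{x}=x_0+\sum_{j=1}^5x_je_j\in\mathbb{R}_5$; $\bar x=x_0-\underline{x}$, $|x|^2=\sum_{j=0}^5x_j^2$, $\mathrm{Re}(x)=x_0$. $\mathbb{S}=\{\underline{x}:\ x_1^2+\dots+x_5^2=1\}$ and $[x]=\{\mathrm{Re}(x)+I|\underline{x}|:\ I\in\mathbb{S}\}$. $V$ is a real Banach space, $V_5=V\otimes\mathbb{R}_5$ the associated two-sided Clifford Banach module, $\mathcal{B}(V_5)$ the bounded right-linear operators on $V_5$. Elements $a\in\mathbb{R}_5$ act on $V_5$ by left multiplication, and products such as $aT$, $Ta$ are compositions of operators. $\mathcal{BC}^{0,1}(V_5)$ is the set of operators $T=T_0+\sum_{j=1}^5e_jT_j$ whose components $T_0,\dots,T_5$ are bounded operators on $V$ that commute pairwise. For such $T$, $\overline{T}=T_0-\sum_{j=1}^5e_jT_j$. For $T\in\mathcal{BC}^{0,1}(V_5)$ the $S$-spectrum is $\sigma_S(T)=\{s\in\mathbb{R}^6: T^2-2\mathrm{Re}(s)T+|s|^2\mathcal{I}\text{ is not invertible in }\mathcal{B}(V_5)\}$; it is known to coincide with the set of $s\in\mathbb{R}^6$ for which $s^2\mathcal{I}-s(T+\overline{T})+T\overline{T}$ is not invertible (so $\sigma_S(\overline T)=\sigma_S(T)$).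 $\rho_S(T)=\mathbb{R}^6\setminus\sigma_S(T)$. For $s\in\rho_S(T)$: $$\mathcal{Q}_{c,s}^{-1}(T)=(s^2\mathcal{I}-s(T+\overline{T})+T\overline{T})^{-1},\quad \mathcal{Q}_{c,s}^{-2}(T)=(\mathcal{Q}_{c,s}^{-1}(T))^2,$$ $$S_L^{-1}(s,T)=(s\mathcal{I}-\overline{T})\mathcal{Q}_{c,s}^{-1}(T),\quad S_R^{-1}(s,T)=\mathcal{Q}_{c,s}^{-1}(T)(s\mathcal{I}-\overline{T}),$$ $$S_{D,L}^{-1}(s,T)=S_{D,R}^{-1}(s,T)=-4\mathcal{Q}_{c,s}^{-1}(T),\quad S_{D\Delta,L}^{-1}(s,T)=S_{D\Delta,R}^{-1}(s,T)=16\mathcal{Q}_{c,s}^{-2}(T),$$ $$S_{\Delta,L}^{-1}(s,T)=-8S_L^{-1}(s,T)\mathcal{Q}_{c,s}^{-1}(T),\quad S_{\Delta,R}^{-1}(s,T)=-8\mathcal{Q}_{c,s}^{-1}(T)S_R^{-1}(s,T).$$ The same formulas with $\overline{T}$ in place of $T$ (and $T$ in place of $\overline T$) define the operators at $\overline T$; note $\mathcal{Q}_{c,s}^{-1}(\overline T)=\mathcal{Q}_{c,s}^{-1}(T)$. Finally $Q_s(p)=p^2-2s_0p+|s|^2$ with $s_0=\mathrm{Re}(s)$, and $Q_s^{-1}(p)=Q_s(p)^{-1}$. *)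

theory Defs
  imports "HOL-Analysis.Analysis"
begin

text \<open>
  The imaginary units are indexed by the type 5, in which the numeral 5 equals 0; its linear order
  is 0 < 1 < 2 < 3 < 4, so the unit e_5 is listed first (the numbering of the units is immaterial).
  A subset A = {a_1 < ... < a_k} of the type stands for the basis element
  e_A = e_{a_1} ... e_{a_k}.  Sorting e_A e_B costs a sign for each pair a > b (anticommutation)
  and for each pair a = b (the squares are -1), hence
  e_A e_B = blade_sign A B * e_{A symmetric-difference B}.
\<close>

type_synonym blade = "5 set"

definition blade_sign :: "blade \<Rightarrow> blade \<Rightarrow> real" where
  "blade_sign A B = (-1) ^ card {(a, b). a \<in> A \<and> b \<in> B \<and> b \<le> a}"

typedef cliff = "UNIV :: (real ^ blade) set"
  morphisms coeffs Cliff by simp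

setup_lifting type_definition_cliff

text \<open>In the product, the coefficient at C collects the pairs of blades A, B whose symmetric
  difference is C, that is, B = sym_diff A C.\<close>

instantiation cliff :: "{real_vector, one, times}"
begin

lift_definition zero_cliff :: cliff is 0 .
lift_definition one_cliff :: cliff is "axis {} 1" .
lift_definition plus_cliff :: "cliff \<Rightarrow> cliff \<Rightarrow> cliff" is "(+)" .
lift_definition minus_cliff :: "cliff \<Rightarrow> cliff \<Rightarrow> cliff" is "(-)" .
lift_definition uminus_cliff :: "cliff \<Rightarrow> cliff" is "uminus" .
lift_definition scaleR_cliff :: "real \<Rightarrow> cliff \<Rightarrow> cliff" is "scaleR" .
lift_definition times_cliff :: "cliff \<Rightarrow> cliff \<Rightarrow> cliff" is
  "\<lambda>x y. \<chi> C. \<Sum>A\<in>UNIV. blade_sign A (sym_diff A C) * (x $ A) * (y $ sym_diff A C)" .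

instance
  by standard (transfer; simp add: algebra_simps)+

end

lemma sym_diff_cancel: "sym_diff A (sym_diff A B) = B"
  by auto

lemma sym_diff_eq_iff: "sym_diff A B = C \<longleftrightarrow> B = sym_diff A C"
proof
  assume "sym_diff A B = C"
  then show "B = sym_diff A C" by (simp only: sym_diff_cancel flip: \<open>sym_diff A B = C\<close>)
next
  assume "B = sym_diff A C"
  then show "sym_diff A B = C" by (simp only: sym_diff_cancel)
qed

lemma prod_sym_diff:
  fixes f :: "'a::finite \<Rightarrow> real"
  assumes "\<And>a. f a * f a = 1"
  shows "prod f (sym_diff A B) = prod f A * prod f B"
proof -
  have 1: "prod f A = prod f (A - B) * prod f (A \<inter> B)"
    by (subst prod.union_disjoint [symmetric]) (auto intro: prod.cong)
  have 2: "prod f B = prod f (B - A) * prod f (A \<inter> B)"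
    by (subst prod.union_disjoint [symmetric]) (auto intro: prod.cong)
  have 3: "prod f (A \<inter> B) * prod f (A \<inter> B) = 1"
    by (simp add: prod.distrib [symmetric] assms)
  have "prod f (sym_diff A B) = prod f (A - B) * prod f (B - A)"
    by (rule prod.union_disjoint) auto
  with 1 2 3 show ?thesis
    by (simp add: mult.assoc mult.left_commute)
qed

lemma blade_sign_prod:
  "blade_sign A B = (\<Prod>a\<in>A. \<Prod>b\<in>B. if b \<le> a then -1 else 1)"
proof -
  have "{(a, b). a \<in> A \<and> b \<in> B \<and> b \<le> a} = Sigma A (\<lambda>a. {b \<in> B. b \<le> a})"
    by auto
  hence "blade_sign A B = (\<Prod>a\<in>A. (-1) ^ card {b \<in> B. b \<le> a})"
    by (simp add: blade_sign_def card_SigmaI power_sum)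
  also have "\<dots> = (\<Prod>a\<in>A. \<Prod>b\<in>B. if b \<le> a then -1 else 1)"
    by (intro prod.cong refl) (simp add: prod.If_cases Int_def)
  finally show ?thesis .
qed

lemma blade_sign_sym_diff_left:
  "blade_sign (sym_diff A B) C = blade_sign A C * blade_sign B C"
  unfolding blade_sign_prod
  by (rule prod_sym_diff) (simp add: prod.distrib [symmetric] if_distrib cong: if_cong)

lemma blade_sign_sym_diff_right:
  "blade_sign C (sym_diff A B) = blade_sign C A * blade_sign C B"
  unfolding blade_sign_prod prod.distrib [symmetric]
  by (intro prod.cong refl prod_sym_diff) auto

lemma sum_sym_diff: "(\<Sum>B\<in>UNIV. g (sym_diff A B)) = (\<Sum>B\<in>(UNIV :: 'a::finite set set). g B)"
  by (rule sum.reindex_bij_witness [of _ "sym_diff A" "sym_diff A"]) (simp_all only: sym_diff_cancel UNIV_I)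

lemma blade_sign_empty [simp]: "blade_sign {} A = 1" "blade_sign A {} = 1"
  by (simp_all add: blade_sign_prod)

lemma cliff_mult_assoc: "(x * y) * z = x * (y * (z :: cliff))"
proof (transfer, rule vec_eq_iff [THEN iffD2], rule allI)
  fix x y z :: "real ^ blade" and D
  let ?s = "blade_sign" and ?d = "sym_diff :: blade \<Rightarrow> blade \<Rightarrow> blade"
  have sign: "?s (?d A B) (?d (?d A B) D) * ?s A B = ?s A (?d A D) * ?s B (?d B (?d A D))" for A B
  proof -
    have e: "?d (?d A B) D = ?d B (?d A D)"
      by auto
    have e2: "?s A (?d A D) = ?s A B * ?s A (?d B (?d A D))"
      by (simp only: blade_sign_sym_diff_right [symmetric] sym_diff_cancel)
    have "?s A B * ?s A B = 1"
      by (simp add: blade_sign_prod prod.distrib [symmetric] if_distrib cong: if_cong)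
    then show ?thesis
      unfolding e e2 blade_sign_sym_diff_left by (simp add: mult_ac)
  qed
  have "(\<Sum>C\<in>UNIV. ?s C (?d C D) * (\<Sum>A\<in>UNIV. ?s A (?d A C) * x $ A * y $ (?d A C)) * z $ (?d C D))
     = (\<Sum>A\<in>UNIV. \<Sum>C\<in>UNIV. ?s C (?d C D) * (?s A (?d A C) * x $ A * y $ (?d A C)) * z $ (?d C D))"
    by (simp only: sum_distrib_left sum_distrib_right) (rule sum.swap)
  also have "\<dots> = (\<Sum>A\<in>UNIV. \<Sum>B\<in>UNIV. ?s (?d A B) (?d (?d A B) D) *
      (?s A (?d A (?d A B)) * x $ A * y $ (?d A (?d A B))) * z $ (?d (?d A B) D))"
    by (intro sum.cong refl sum_sym_diff [symmetric])
  also have "\<dots> = (\<Sum>A\<in>UNIV. \<Sum>B\<in>UNIV. ?s A (?d A D) * x $ A * (?s B (?d B (?d A D)) * y $ B * z $ (?d B (?d A D))))"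
  proof (intro sum.cong refl)
    fix A B :: blade
    have e: "?d B (?d A D) = ?d (?d A B) D"
      by auto
    show "?s (?d A B) (?d (?d A B) D) *
      (?s A (?d A (?d A B)) * x $ A * y $ (?d A (?d A B))) * z $ (?d (?d A B) D)
      = ?s A (?d A D) * x $ A * (?s B (?d B (?d A D)) * y $ B * z $ (?d B (?d A D)))"
      using sign [of A B] unfolding sym_diff_cancel e by algebra
  qed
  finally show "(\<chi> C. \<Sum>A\<in>UNIV. ?s A (?d A C) * (\<chi> C. \<Sum>A\<in>UNIV. ?s A (?d A C) * x $ A * y $ (?d A C)) $ A * z $ (?d A C)) $ D =
     (\<chi> C. \<Sum>A\<in>UNIV. ?s A (?d A C) * x $ A * (\<chi> C. \<Sum>A\<in>UNIV. ?s A (?d A C) * y $ A * z $ (?d A C)) $ (?d A C)) $ D"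
    by (simp only: vec_lambda_beta sum_distrib_left)
qed

instance cliff :: real_algebra_1
proof
  fix x y z :: cliff and r :: real
  show "x * y * z = x * (y * z)" by (rule cliff_mult_assoc)
  show "(x + y) * z = x * z + y * z"
    by transfer (simp add: vec_eq_iff algebra_simps sum.distrib)
  show "x * (y + z) = x * y + x * z"
    by transfer (simp add: vec_eq_iff algebra_simps sum.distrib)
  show "r *\<^sub>R x * y = r *\<^sub>R (x * y)"
    by transfer (simp add: vec_eq_iff sum_distrib_left mult_ac)
  show "x * r *\<^sub>R y = r *\<^sub>R (x * y)"
    by transfer (simp add: vec_eq_iff sum_distrib_left mult_ac)
  show "1 * x = x"
  proof (transfer, simp only: vec_eq_iff vec_lambda_beta, rule allI)
    fix x :: "real ^ blade" and C
    have "(\<Sum>A\<in>UNIV. blade_sign A (sym_diff A C) * (axis {} 1 :: real ^ blade) $ A * x $ sym_diff A C)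
        = (\<Sum>A\<in>(UNIV :: blade set). if A = {} then x $ C else 0)"
      by (rule sum.cong) (auto simp: axis_def)
    then show "(\<Sum>A\<in>UNIV. blade_sign A (sym_diff A C) * (axis {} 1 :: real ^ blade) $ A * x $ sym_diff A C) = x $ C"
      by simp
  qed
  show "x * 1 = x"
  proof (transfer, simp only: vec_eq_iff vec_lambda_beta, rule allI)
    fix x :: "real ^ blade" and C
    have "(\<Sum>A\<in>UNIV. blade_sign A (sym_diff A C) * x $ A * (axis {} 1 :: real ^ blade) $ sym_diff A C)
        = (\<Sum>A\<in>UNIV. if A = C then x $ C else 0)"
      by (rule sum.cong) (auto simp: axis_def)
    then show "(\<Sum>A\<in>UNIV. blade_sign A (sym_diff A C) * x $ A * (axis {} 1 :: real ^ blade) $ sym_diff A C) = x $ C"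
      by simp
  qed
  show "(0 :: cliff) \<noteq> 1"
    by transfer (auto simp: vec_eq_iff axis_def)
qed

lift_definition cliff_e :: "5 \<Rightarrow> cliff" is "\<lambda>j. axis {j} 1" .

lemma cliff_e_coeff: "coeffs (cliff_e j) $ A = (if A = {j} then 1 else 0)"
  by transfer (auto simp: axis_def)

lemma cliff_e_mult_coeff:
  "coeffs (cliff_e j * cliff_e k) $ C = (if C = sym_diff {j} {k} then blade_sign {j} {k} else 0)"
proof -
  have "coeffs (cliff_e j * cliff_e k) $ C
     = (\<Sum>A\<in>UNIV. if A = {j} then blade_sign {j} (sym_diff {j} C) * coeffs (cliff_e k) $ sym_diff {j} C else 0)"
    by (simp only: times_cliff.rep_eq vec_lambda_beta, rule sum.cong) (auto simp: cliff_e_coeff)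
  also have "\<dots> = blade_sign {j} (sym_diff {j} C) * coeffs (cliff_e k) $ sym_diff {j} C"
    by simp
  also have "\<dots> = (if sym_diff {j} C = {k} then blade_sign {j} {k} else 0)"
    by (simp add: cliff_e_coeff)
  also have "sym_diff {j} C = {k} \<longleftrightarrow> C = sym_diff {j} {k}"
    by auto
  finally show ?thesis .
qed

lemma cliff_e_square: "cliff_e j * cliff_e j = -1"
proof -
  have "coeffs (cliff_e j * cliff_e j) = coeffs (-1)"
    by (auto simp: vec_eq_iff cliff_e_mult_coeff uminus_cliff.rep_eq one_cliff.rep_eq axis_def
        blade_sign_prod)
  then show ?thesis by (simp only: coeffs_inject)
qed

lemma cliff_e_anticommute: "j \<noteq> k \<Longrightarrow> cliff_e j * cliff_e k + cliff_e k * cliff_e j = 0"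
proof -
  assume "j \<noteq> k"
  then have "coeffs (cliff_e j * cliff_e k + cliff_e k * cliff_e j) = coeffs 0"
    by (auto simp: vec_eq_iff plus_cliff.rep_eq zero_cliff.rep_eq cliff_e_mult_coeff blade_sign_prod)
  then show ?thesis by (simp only: coeffs_inject)
qed

text \<open>Each basis element really is the ordered product of its imaginary units.\<close>

lemma blade_insert:
  assumes "\<And>a. a \<in> A \<Longrightarrow> a < j"
  shows "Cliff (axis A 1) * cliff_e j = Cliff (axis (insert j A) 1)"
proof -
  have j: "j \<notin> A" using assms by blast
  have s: "blade_sign A {j} = 1"
    using assms by (auto simp: blade_sign_prod not_le intro!: prod.neutral)
  have "coeffs (Cliff (axis A 1) * cliff_e j) $ C = axis (insert j A) 1 $ C" for C
  proof -
    have "coeffs (Cliff (axis A 1) * cliff_e j) $ C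
       = (\<Sum>B\<in>UNIV. if B = A then blade_sign A (sym_diff A C) * coeffs (cliff_e j) $ sym_diff A C else 0)"
      by (simp only: times_cliff.rep_eq vec_lambda_beta, rule sum.cong)
         (auto simp: axis_def Cliff_inverse)
    also have "\<dots> = blade_sign A (sym_diff A C) * coeffs (cliff_e j) $ sym_diff A C"
      by simp
    also have "\<dots> = (if sym_diff A C = {j} then 1 else 0)"
      by (auto simp: cliff_e_coeff s)
    also have "sym_diff A C = {j} \<longleftrightarrow> C = sym_diff A {j}"
      by (rule sym_diff_eq_iff)
    also have "sym_diff A {j} = insert j A"
      using j by auto
    finally show ?thesis by (simp add: axis_def)
  qed
  then show ?thesis
    by (simp add: vec_eq_iff Cliff_inverse flip: coeffs_inject)
qed

definition cliff_inverse :: "cliff \<Rightarrow> cliff" where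
  "cliff_inverse a = (THE b. a * b = 1 \<and> b * a = 1)"


definition para :: "real \<Rightarrow> (5 \<Rightarrow> real) \<Rightarrow> cliff" where
  "para x0 x = of_real x0 + (\<Sum>j\<in>UNIV. x j *\<^sub>R cliff_e j)"

text \<open>The image of R^6 in the Clifford algebra.\<close>

definition paravectors :: "cliff set" where
  "paravectors = {para x0 x | x0 x. True}"

definition Re_c :: "cliff \<Rightarrow> real" where
  "Re_c x = coeffs x $ {}"

definition Vec_c :: "cliff \<Rightarrow> cliff" where
  "Vec_c x = (\<Sum>j\<in>UNIV. (coeffs x $ {j}) *\<^sub>R cliff_e j)"

text \<open>The functions \<open>cnj_c\<close>, \<open>abs_c\<close> and \<open>class_c\<close> have the intended meaning on paravectors only.\<close>

definition cnj_c :: "cliff \<Rightarrow> cliff" where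
  "cnj_c x = of_real (Re_c x) - Vec_c x"

definition abs_c :: "cliff \<Rightarrow> real" where
  "abs_c x = sqrt ((coeffs x $ {})\<^sup>2 + (\<Sum>j\<in>UNIV. (coeffs x $ {j})\<^sup>2))"

definition sphere_c :: "cliff set" where
  "sphere_c = {(\<Sum>j\<in>UNIV. x j *\<^sub>R cliff_e j) | x. (\<Sum>j\<in>UNIV. (x j)\<^sup>2) = 1}"

definition class_c :: "cliff \<Rightarrow> cliff set" where
  "class_c x = {of_real (Re_c x) + I * of_real (abs_c (Vec_c x)) | I. I \<in> sphere_c}"

lemma para_coeffs:
  "coeffs (para x0 x) $ A = (if A = {} then x0 else if \<exists>j. A = {j} then x (THE j. A = {j}) else 0)"
proof -
  have sc: "coeffs (\<Sum>j\<in>S. x j *\<^sub>R cliff_e j) $ A = (\<Sum>j\<in>S. x j * coeffs (cliff_e j) $ A)" for S :: "5 set"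
    by (induction S rule: infinite_finite_induct)
       (auto simp: plus_cliff.rep_eq scaleR_cliff.rep_eq zero_cliff.rep_eq)
  have "(\<Sum>j\<in>UNIV. x j * coeffs (cliff_e j) $ A) = (if \<exists>j. A = {j} then x (THE j. A = {j}) else 0)"
    by (auto simp: cliff_e_coeff if_distrib [of "\<lambda>c. _ * c"] cong: if_cong)
  with sc show ?thesis
    by (auto simp: para_def of_real_def plus_cliff.rep_eq scaleR_cliff.rep_eq one_cliff.rep_eq axis_def)
qed

lemma para_simps:
  "Re_c (para x0 x) = x0"
  "Vec_c (para x0 x) = para 0 x"
  "cnj_c (para x0 x) = para x0 (\<lambda>j. - x j)"
  "abs_c (para x0 x) = sqrt (x0\<^sup>2 + (\<Sum>j\<in>UNIV. (x j)\<^sup>2))"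
proof -
  show Re: "Re_c (para x0 x) = x0"
    by (simp add: Re_c_def para_coeffs)
  show Vec: "Vec_c (para x0 x) = para 0 x"
    by (simp add: Vec_c_def para_coeffs) (simp add: para_def)
  show "cnj_c (para x0 x) = para x0 (\<lambda>j. - x j)"
    by (simp add: cnj_c_def Re Vec) (simp add: para_def sum_negf)
  show "abs_c (para x0 x) = sqrt (x0\<^sup>2 + (\<Sum>j\<in>UNIV. (x j)\<^sup>2))"
    by (simp add: abs_c_def para_coeffs)
qed


text \<open>
  An element of the tensor product of V with the Clifford algebra is given by its components
  v_A in V with respect to the basis elements e_A; the norm of the vector type is the square root
  of the sum of the squared norms of the components.
\<close>

type_synonym 'v cmod = "'v ^ blade"
type_synonym 'v cop = "'v cmod \<Rightarrow>\<^sub>L 'v cmod"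

definition lact :: "cliff \<Rightarrow> 'v::banach cmod \<Rightarrow> 'v cmod" where
  "lact a v = (\<chi> C. \<Sum>A\<in>UNIV. (blade_sign A (sym_diff A C) * coeffs a $ A) *\<^sub>R (v $ sym_diff A C))"

definition ract :: "'v::banach cmod \<Rightarrow> cliff \<Rightarrow> 'v cmod" where
  "ract v a = (\<chi> C. \<Sum>A\<in>UNIV. (blade_sign A (sym_diff A C) * coeffs a $ sym_diff A C) *\<^sub>R (v $ A))"

lemma bounded_linear_vec_lambda:
  fixes f :: "'i::finite \<Rightarrow> 'a::real_normed_vector \<Rightarrow> 'b::real_normed_vector"
  assumes "\<And>i. bounded_linear (f i)"
  shows "bounded_linear (\<lambda>x. \<chi> i. f i x)"
proof -
  interpret bounded_linear "f i" for i by (rule assms)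
  have "\<forall>i. \<exists>K. \<forall>x. norm (f i x) \<le> norm x * K"
    using bounded by blast
  then obtain K where K: "\<And>i x. norm (f i x) \<le> norm x * K i"
    by metis
  show ?thesis
  proof (rule bounded_linear_intro [where K = "\<Sum>i\<in>UNIV. K i"])
    fix x
    have "norm (\<chi> i. f i x) \<le> (\<Sum>i\<in>UNIV. norm (f i x))"
      using norm_le_l1_cart L2_set_le_sum [of UNIV "\<lambda>i. norm (f i x)"] by (simp add: norm_vec_def)
    also have "\<dots> \<le> norm x * (\<Sum>i\<in>UNIV. K i)"
      by (simp add: sum_distrib_left sum_mono K)
    finally show "norm (\<chi> i. f i x) \<le> norm x * (\<Sum>i\<in>UNIV. K i)" .
  qed (simp_all add: vec_eq_iff add scaleR)
qed

lift_definition lmul :: "cliff \<Rightarrow> 'v::banach cop" is lact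
  unfolding lact_def
  by (rule bounded_linear_vec_lambda, rule bounded_linear_sum,
      rule bounded_linear_const_scaleR, rule bounded_linear_vec_nth)

lift_definition extend :: "('v::banach \<Rightarrow>\<^sub>L 'v) \<Rightarrow> 'v cop" is "\<lambda>F v. \<chi> A. F (v $ A)"
  by (rule bounded_linear_vec_lambda, erule bounded_linear_compose, rule bounded_linear_vec_nth)

abbreviation op_prod :: "'v::banach cop \<Rightarrow> 'v cop \<Rightarrow> 'v cop" (infixl "\<odot>" 70) where
  "F \<odot> G \<equiv> F o\<^sub>L G"

definition right_linear_ops :: "'v::banach cop set" where
  "right_linear_ops = {F. \<forall>v a. blinfun_apply F (ract v a) = ract (blinfun_apply F v) a}"

definition is_op_inverse :: "'v::banach cop \<Rightarrow> 'v cop \<Rightarrow> bool" where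
  "is_op_inverse F G \<longleftrightarrow> G \<in> right_linear_ops \<and> F \<odot> G = id_blinfun \<and> G \<odot> F = id_blinfun"

definition op_invertible :: "'v::banach cop \<Rightarrow> bool" where
  "op_invertible F \<longleftrightarrow> (\<exists>G. is_op_inverse F G)"

definition op_inverse :: "'v::banach cop \<Rightarrow> 'v cop" where
  "op_inverse F = (THE G. is_op_inverse F G)"


definition para_op :: "('v::banach \<Rightarrow>\<^sub>L 'v) \<Rightarrow> (5 \<Rightarrow> ('v \<Rightarrow>\<^sub>L 'v)) \<Rightarrow> 'v cop" where
  "para_op T0 T = extend T0 + (\<Sum>j\<in>UNIV. lmul (cliff_e j) \<odot> extend (T j))"

definition BC01 :: "'v::banach cop set" where
  "BC01 = {para_op T0 T | T0 T.
     (\<forall>j. T0 o\<^sub>L T j = T j o\<^sub>L T0) \<and> (\<forall>j k. T j o\<^sub>L T k = T k o\<^sub>L T j)}"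

text \<open>The components are determined by the operator, see \<open>op_cnj_para_op\<close> below.\<close>

definition op_cnj :: "'v::banach cop \<Rightarrow> 'v cop" where
  "op_cnj F = (THE G. \<exists>T0 T. F = para_op T0 T \<and> G = para_op T0 (\<lambda>j. - T j))"

lemma lact_cliff_e_axis: "lact (cliff_e j) (axis {} v) = axis {j} v"
proof -
  have "lact (cliff_e j) (axis {} v) $ C = axis {j} v $ C" for C
  proof -
    have "lact (cliff_e j) (axis {} v) $ C
       = (\<Sum>A\<in>UNIV. if A = {j} then blade_sign {j} (sym_diff {j} C) *\<^sub>R axis {} v $ sym_diff {j} C else 0)"
      by (simp only: lact_def vec_lambda_beta, rule sum.cong) (auto simp: cliff_e_coeff)
    also have "\<dots> = blade_sign {j} (sym_diff {j} C) *\<^sub>R axis {} v $ sym_diff {j} C"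
      by simp
    also have "\<dots> = axis {j} v $ C"
      by (auto simp: axis_def)
    finally show ?thesis .
  qed
  then show ?thesis by (simp add: vec_eq_iff)
qed

lemma para_op_axis:
  "blinfun_apply (para_op T0 T) (axis {} v) = axis {} (T0 v) + (\<Sum>j\<in>UNIV. axis {j} (T j v))"
proof -
  have "blinfun_apply (extend F) (axis {} v) = axis {} (F v)" for F :: "'a \<Rightarrow>\<^sub>L 'a"
    by (auto simp: extend.rep_eq vec_eq_iff axis_def blinfun.zero_right)
  then show ?thesis
    by (simp add: para_op_def blinfun.add_left blinfun.sum_left lmul.rep_eq lact_cliff_e_axis)
qed

lemma para_op_inject: "para_op T0 T = para_op S0 S \<longleftrightarrow> T0 = S0 \<and> T = S"
proof
  assume eq: "para_op T0 T = para_op S0 S"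
  have c: "(axis {} (T0 v) + (\<Sum>j\<in>UNIV. axis {j} (T j v))) $ A
      = (axis {} (S0 v) + (\<Sum>j\<in>UNIV. axis {j} (S j v))) $ A" for v A
    using arg_cong [OF eq, of "\<lambda>F. blinfun_apply F (axis {} v)"] by (simp add: para_op_axis)
  have "T0 v = S0 v" for v
    using c [of v "{}"] by (simp add: axis_def)
  moreover have "T k v = S k v" for k v
    using c [of v "{k}"] by (simp add: axis_def)
  ultimately show "T0 = S0 \<and> T = S"
    by (auto intro!: blinfun_eqI ext)
qed simp

lemma op_cnj_para_op: "op_cnj (para_op T0 T) = para_op T0 (\<lambda>j. - T j)"
  unfolding op_cnj_def by (rule the_equality) (auto simp: para_op_inject)


definition S_spectrum :: "'v::banach cop \<Rightarrow> cliff set" where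
  "S_spectrum T = {s \<in> paravectors.
     \<not> op_invertible (T \<odot> T - (2 * Re_c s) *\<^sub>R T + (abs_c s)\<^sup>2 *\<^sub>R id_blinfun)}"

definition S_resolvent_set :: "'v::banach cop \<Rightarrow> cliff set" where
  "S_resolvent_set T = paravectors - S_spectrum T"

definition Qc_inv :: "cliff \<Rightarrow> 'v::banach cop \<Rightarrow> 'v cop" where
  "Qc_inv s T = op_inverse (lmul (s\<^sup>2) - lmul s \<odot> (T + op_cnj T) + T \<odot> op_cnj T)"

definition Qc_inv2 :: "cliff \<Rightarrow> 'v::banach cop \<Rightarrow> 'v cop" where
  "Qc_inv2 s T = Qc_inv s T \<odot> Qc_inv s T"

definition S_L :: "cliff \<Rightarrow> 'v::banach cop \<Rightarrow> 'v cop" where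
  "S_L s T = (lmul s - op_cnj T) \<odot> Qc_inv s T"

definition S_R :: "cliff \<Rightarrow> 'v::banach cop \<Rightarrow> 'v cop" where
  "S_R s T = Qc_inv s T \<odot> (lmul s - op_cnj T)"

definition S_D_L :: "cliff \<Rightarrow> 'v::banach cop \<Rightarrow> 'v cop" where
  "S_D_L s T = (-4) *\<^sub>R Qc_inv s T"

definition S_D_R :: "cliff \<Rightarrow> 'v::banach cop \<Rightarrow> 'v cop" where
  "S_D_R s T = (-4) *\<^sub>R Qc_inv s T"

definition S_DDelta_L :: "cliff \<Rightarrow> 'v::banach cop \<Rightarrow> 'v cop" where
  "S_DDelta_L s T = 16 *\<^sub>R Qc_inv2 s T"

definition S_DDelta_R :: "cliff \<Rightarrow> 'v::banach cop \<Rightarrow> 'v cop" where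
  "S_DDelta_R s T = 16 *\<^sub>R Qc_inv2 s T"

definition S_Delta_L :: "cliff \<Rightarrow> 'v::banach cop \<Rightarrow> 'v cop" where
  "S_Delta_L s T = (-8) *\<^sub>R (S_L s T \<odot> Qc_inv s T)"

definition S_Delta_R :: "cliff \<Rightarrow> 'v::banach cop \<Rightarrow> 'v cop" where
  "S_Delta_R s T = (-8) *\<^sub>R (Qc_inv s T \<odot> S_R s T)"

definition Q_poly :: "cliff \<Rightarrow> cliff \<Rightarrow> cliff" where
  "Q_poly s p = p\<^sup>2 - 2 * of_real (Re_c s) * p + of_real ((abs_c s)\<^sup>2)"

definition Q_poly_inv :: "cliff \<Rightarrow> cliff \<Rightarrow> cliff" where
  "Q_poly_inv s p = cliff_inverse (Q_poly s p)"

end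

theory Submission
  imports Defs
begin

text \<open>
  Write A and B for the inverses of Q(s) = s^2 - s t + n and Q(p) = p^2 - p t + n, where
  t = T + cnj T and n = T (cnj T).  Because the components of T commute, t and n act on the
  components of a module element only, so they commute with every left multiplication and with
  each other; thus A commutes with s and with cnj s, and B with p, although s and p need not commute.

  On both left-hand sides the terms with the same factors combine, and T and its conjugate occur
  only through their sum: either side is 16 (A M B^2 + A^2 M B) with M = s + p - t.  Everything
  then follows from the single kernel equation
    A M B = ((A - B) p - cnj s (A - B)) / Q_s(p),
  used once with a factor A on the left and once with a factor B on the right; when the two are
  added, the mixed terms A B cancel and leave A^2 - B^2
  (\<open>resolvent_equation_of_commuting_inverses\<close>).  Cleared of inverses, the kernel equation reads
    M Q_s(p) = (Q(p) - Q(s)) p - cnj s (Q(p) - Q(s)),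
  and comparing the parts with and without t reduces it to two identities between s and p in the
  Clifford algebra (\<open>Q_poly_kernel_identity\<close>).

  Two existence questions remain.  The element Q_s(p) is a paravector, which vanishes only if s lies
  in the class of p (\<open>Q_poly_invertible\<close>).  The resolvent set speaks about
  P(T) = T^2 - 2 s_0 T + |s|^2 and not about Q(s).  The two are related by
  P(T) P(cnj T) = Q(s) Q(cnj s), and P(cnj T) is invertible together with P(T) because the grade
  involution of the module conjugates T into cnj T (\<open>Qc_inverse\<close>).
\<close>

section \<open>Paravectors and the polynomial of a class\<close>

text \<open>
  This is how anticommuting units make the square of a vector scalar; it serves for vectors with
  real coefficients and for vectors with commuting operators as coefficients.
\<close>

lemma sum_antisymmetric_off_diagonal:
  fixes f :: "'i::finite \<Rightarrow> 'i \<Rightarrow> 'a::real_vector"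
  assumes "\<And>j k. j \<noteq> k \<Longrightarrow> f j k + f k j = 0"
  shows "(\<Sum>j\<in>UNIV. \<Sum>k\<in>UNIV. f j k) = (\<Sum>j\<in>UNIV. f j j)"
proof -
  have "2 *\<^sub>R (\<Sum>j\<in>UNIV. \<Sum>k\<in>UNIV. f j k)
      = (\<Sum>j\<in>UNIV. \<Sum>k\<in>UNIV. f j k) + (\<Sum>k\<in>UNIV. \<Sum>j\<in>UNIV. f j k)"
    by (subst (3) sum.swap) (simp add: scaleR_2)
  also have "\<dots> = (\<Sum>j\<in>UNIV. \<Sum>k\<in>UNIV. f j k + f k j)"
    by (simp add: sum.distrib)
  also have "\<dots> = (\<Sum>j\<in>UNIV. \<Sum>k\<in>UNIV. if j = k then 2 *\<^sub>R f j j else 0)"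
    using assms by (intro sum.cong refl) (auto simp: scaleR_2)
  also have "\<dots> = 2 *\<^sub>R (\<Sum>j\<in>UNIV. f j j)"
    by (simp add: scaleR_right.sum)
  finally show ?thesis by simp
qed

lemma para_0_square: "para 0 x * para 0 x = - of_real (\<Sum>j\<in>UNIV. (x j)\<^sup>2)"
proof -
  have "para 0 x * para 0 x
      = (\<Sum>j\<in>UNIV. \<Sum>k\<in>UNIV. (x j * x k) *\<^sub>R (cliff_e j * cliff_e k))"
    by (simp add: para_def sum_product mult.commute)
  also have "\<dots> = (\<Sum>j\<in>UNIV. (x j * x j) *\<^sub>R (cliff_e j * cliff_e j))"
  proof (rule sum_antisymmetric_off_diagonal)
    fix j k :: 5
    assume "j \<noteq> k"
    then show "(x j * x k) *\<^sub>R (cliff_e j * cliff_e k) + (x k * x j) *\<^sub>R (cliff_e k * cliff_e j) = 0"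
      using cliff_e_anticommute [of j k] by (simp add: mult.commute flip: scaleR_add_right)
  qed
  also have "\<dots> = - of_real (\<Sum>j\<in>UNIV. (x j)\<^sup>2)"
    by (simp add: cliff_e_square of_real_def scaleR_sum_left power2_eq_square sum_negf)
  finally show ?thesis .
qed

lemma para_split: "para x0 x = of_real x0 + para 0 x"
  by (simp add: para_def)

lemma para_uminus: "para 0 (\<lambda>j. - x j) = - para 0 x"
  by (simp add: para_def sum_negf)

lemma paravector_times_cnj:
  assumes "s \<in> paravectors"
  shows "s * cnj_c s = of_real ((abs_c s)\<^sup>2)"
    and "cnj_c s * s = of_real ((abs_c s)\<^sup>2)"
    and "s + cnj_c s = of_real (2 * Re_c s)"
proof -
  obtain x0 x where s: "s = para x0 x"
    using assms by (auto simp: paravectors_def)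
  have cnj: "cnj_c s = of_real x0 - para 0 x"
    unfolding s para_simps by (subst para_split) (simp add: para_uminus)
  have abs: "(abs_c s)\<^sup>2 = x0\<^sup>2 + (\<Sum>j\<in>UNIV. (x j)\<^sup>2)"
    unfolding s para_simps by (simp add: sum_nonneg)
  have Re: "Re_c s = x0"
    by (simp add: s para_simps)
  have comm: "of_real x0 * para 0 x = para 0 x * of_real x0"
    by (simp add: of_real_def)
  have s': "s = of_real x0 + para 0 x"
    unfolding s by (rule para_split)
  show "s * cnj_c s = of_real ((abs_c s)\<^sup>2)" "cnj_c s * s = of_real ((abs_c s)\<^sup>2)"
    unfolding abs cnj by (simp_all add: s' algebra_simps comm para_0_square power2_eq_square)
  show "s + cnj_c s = of_real (2 * Re_c s)"
    unfolding cnj Re by (simp add: s' flip: mult_2)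
qed

lemma cliff_inverse_eq:
  assumes "a * b = 1" "b * a = 1"
  shows "cliff_inverse a = b"
  unfolding cliff_inverse_def
proof (rule the_equality)
  fix c assume "a * c = 1 \<and> c * a = 1"
  then have "c = (b * a) * c" using assms by simp
  also have "\<dots> = b" using \<open>a * c = 1 \<and> c * a = 1\<close> by (simp add: mult.assoc)
  finally show "c = b" .
qed (use assms in simp)

lemma paravector_invertible:
  assumes "s \<in> paravectors" "s \<noteq> 0"
  shows "s * cliff_inverse s = 1" "cliff_inverse s * s = 1"
proof -
  obtain x0 x where s: "s = para x0 x"
    using assms by (auto simp: paravectors_def)
  have "abs_c s \<noteq> 0"
  proof
    assume "abs_c s = 0"
    then have "x0\<^sup>2 + (\<Sum>j\<in>UNIV. (x j)\<^sup>2) = 0"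
      by (simp add: s para_simps)
    then have "x0 = 0" "\<And>j. x j = 0"
      by (simp_all add: add_nonneg_eq_0_iff sum_nonneg sum_nonneg_eq_0_iff)
    then show False using assms by (simp add: s para_def)
  qed
  then have "s * ((1 / (abs_c s)\<^sup>2) *\<^sub>R cnj_c s) = 1" "((1 / (abs_c s)\<^sup>2) *\<^sub>R cnj_c s) * s = 1"
    using paravector_times_cnj [OF assms(1)] by (simp_all add: of_real_def)
  then show "s * cliff_inverse s = 1" "cliff_inverse s * s = 1"
    by (simp_all only: cliff_inverse_eq)
qed

text \<open>
  A class consists of all paravectors with a given real part and a given length of the vector part,
  because a vector of length r is r times a point of the unit sphere.
\<close>

lemma para_in_class:
  assumes "(\<Sum>j\<in>UNIV. (y j)\<^sup>2) = (\<Sum>j\<in>UNIV. (x j)\<^sup>2)"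
  shows "para x0 y \<in> class_c (para x0 x)"
proof -
  define r where "r = sqrt (\<Sum>j\<in>UNIV. (x j)\<^sup>2)"
  have r: "r\<^sup>2 = (\<Sum>j\<in>UNIV. (y j)\<^sup>2)"
    using assms by (simp add: r_def sum_nonneg)
  obtain z where z: "(\<Sum>j\<in>UNIV. (z j)\<^sup>2) = 1" and y: "\<And>j. y j = r * z j"
  proof (cases "r = 0")
    case True
    then have "y j = 0" for j
      using r by (simp add: sum_nonneg_eq_0_iff)
    (* Both vector parts vanish, so any point of the sphere serves; the unit of index 0 is one. *)
    moreover have "(\<Sum>j\<in>(UNIV :: 5 set). (if j = 0 then 1 else 0 :: real)\<^sup>2) = 1"
      by (simp add: if_distrib [of "\<lambda>u. u\<^sup>2"] cong: if_cong)
    ultimately show ?thesis using that True by fastforce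
  next
    case False
    have "(\<Sum>j\<in>UNIV. (y j / r)\<^sup>2) = (\<Sum>j\<in>UNIV. (y j)\<^sup>2) / r\<^sup>2"
      by (simp add: power_divide sum_divide_distrib)
    also have "\<dots> = 1" using False by (simp flip: r)
    finally show ?thesis using that [of "\<lambda>j. y j / r"] False by simp
  qed
  have "abs_c (Vec_c (para x0 x)) = r"
    by (simp add: para_simps r_def)
  moreover have "para x0 y = of_real x0 + (\<Sum>j\<in>UNIV. z j *\<^sub>R cliff_e j) * of_real r"
    by (simp add: para_def y of_real_def scaleR_right.sum)
  ultimately show ?thesis
    using z by (auto simp: class_c_def sphere_c_def para_simps intro!: exI)
qed

lemma Q_poly_alt: "Q_poly s p = p * p - (2 * Re_c s) *\<^sub>R p + (abs_c s)\<^sup>2 *\<^sub>R 1"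
proof -
  have "2 * of_real (Re_c s) = (of_real (2 * Re_c s) :: cliff)" by simp
  then show ?thesis
    unfolding Q_poly_def by (simp only: of_real_def power2_eq_square) simp
qed

text \<open>
  Since p is a root of its own quadratic, Q_s(p) = 2 (p_0 - s_0) p + |s|^2 - |p|^2.  This is a
  paravector, so it suffices that it is not zero.  If it vanishes, then either p_0 = s_0 and
  |s| = |p|, so s is in the class of p, or p is real and (p_0 - s_0)^2 + |Vec s|^2 = 0, which
  contradicts p_0 \<noteq> s_0.
\<close>

lemma Q_poly_invertible:
  assumes "p \<in> paravectors" "s \<in> paravectors" "s \<notin> class_c p"
  shows "Q_poly s p * Q_poly_inv s p = 1"
proof -
  obtain p0 x where p: "p = para p0 x"
    using assms by (auto simp: paravectors_def)
  obtain s0 y where s: "s = para s0 y"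
    using assms by (auto simp: paravectors_def)
  define X where "X = (\<Sum>j\<in>UNIV. (x j)\<^sup>2)"
  define Y where "Y = (\<Sum>j\<in>UNIV. (y j)\<^sup>2)"
  have Y: "Y \<ge> 0" by (simp add: Y_def sum_nonneg)
  define q0 where "q0 = 2 * (p0 - s0) * p0 + (s0\<^sup>2 + Y) - (p0\<^sup>2 + X)"
  have scale: "para 0 (\<lambda>j. c * x j) = c *\<^sub>R para 0 x" for c
    by (simp add: para_def scaleR_right.sum)
  have abs: "(abs_c s)\<^sup>2 = s0\<^sup>2 + Y"
    using Y unfolding s para_simps by (simp add: Y_def)
  have eq: "Q_poly s p = para q0 (\<lambda>j. 2 * (p0 - s0) * x j)"
  proof -
    have p': "p = of_real p0 + para 0 x" unfolding p by (rule para_split)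
    have Re: "Re_c s = s0" by (simp add: s para_simps)
    have sq: "para 0 x * para 0 x = - of_real X"
      by (simp add: para_0_square X_def)
    have double: "(a * 2) *\<^sub>R z = a *\<^sub>R z + a *\<^sub>R z" for a and z :: cliff
      by (simp add: scaleR_2 scaleR_add_right flip: scaleR_scaleR)
    have "Q_poly s p = of_real q0 + (2 * (p0 - s0)) *\<^sub>R para 0 x"
      unfolding Q_poly_alt abs Re q0_def p'
      by (simp add: of_real_def algebra_simps power2_eq_square sq [unfolded of_real_def]
        double double [of "a * b" for a b, unfolded mult.assoc])
    then show ?thesis by (subst para_split) (simp add: scale)
  qed
  have "Q_poly s p \<noteq> 0"
  proof
    assume "Q_poly s p = 0"
    then have c0: "coeffs (para q0 (\<lambda>j. 2 * (p0 - s0) * x j)) $ A = 0" for A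
      by (simp add: eq zero_cliff.rep_eq)
    have q0: "q0 = 0" using c0 [of "{}"] by (simp add: para_coeffs)
    have qj: "(p0 - s0) * x j = 0" for j using c0 [of "{j}"] by (simp add: para_coeffs)
    show False
    proof (cases "p0 = s0")
      case True
      then have "Y = X" using q0 by (simp add: q0_def)
      then show False using assms(3) para_in_class [of y x p0] True by (simp add: p s X_def Y_def)
    next
      case False
      then have "X = 0" using qj by (simp add: X_def)
      then have "(p0 - s0)\<^sup>2 + Y = 0"
        using q0 by (simp add: q0_def power2_eq_square algebra_simps)
      then show False using Y False by (simp add: add_nonneg_eq_0_iff)
    qed
  qed
  then show ?thesis
    unfolding Q_poly_inv_def by (intro paravector_invertible) (auto simp: eq paravectors_def)
qed

lemma Q_poly_cnj:
  assumes "s \<in> paravectors"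
  shows "Q_poly s p = p * p - (s + cnj_c s) * p + s * cnj_c s"
  by (simp add: Q_poly_def paravector_times_cnj [OF assms] power2_eq_square)

text \<open>
  The numerator of the kernel equation applies x \<mapsto> x p - cnj s x to Q(p) - Q(s), which equals
  (p^2 - s^2) - (p - s) t; the two identities treat the coefficients of t and of 1.  Both identities hold because s + cnj s and s (cnj s) are real and hence
  commute with p.
\<close>

lemma Q_poly_kernel_identity:
  assumes "s \<in> paravectors"
  shows "(p - s) * p - cnj_c s * (p - s) = Q_poly s p"
    and "(p * p - s * s) * p - cnj_c s * (p * p - s * s) = (s + p) * Q_poly s p"
proof -
  note s = paravector_times_cnj [OF assms]
  have c: "cnj_c s = of_real (2 * Re_c s) - s"
    using s(3) by (simp add: algebra_simps)
  show "(p - s) * p - cnj_c s * (p - s) = Q_poly s p"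
    unfolding Q_poly_cnj [OF assms] using s(1,2) by (simp add: algebra_simps)
  define r where "r = 2 * Re_c s"
  define n where "n = (abs_c s)\<^sup>2"
  have ss: "s * s = r *\<^sub>R s - n *\<^sub>R 1"
    using s(1) unfolding c by (simp add: r_def n_def algebra_simps of_real_def)
  have ss': "s * (s * x) = r *\<^sub>R (s * x) - n *\<^sub>R x" for x
    by (simp add: ss algebra_simps flip: mult.assoc)
  have Q: "Q_poly s p = p * p - r *\<^sub>R p + n *\<^sub>R 1"
    by (simp add: Q_poly_alt r_def n_def)
  show "(p * p - s * s) * p - cnj_c s * (p * p - s * s) = (s + p) * Q_poly s p"
    unfolding Q c r_def [symmetric]
    by (simp add: ss ss' of_real_def algebra_simps)
qed

section \<open>Clifford and componentwise multiplication operators\<close>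

lemma blinfun_compose_assoc: "(F o\<^sub>L G) o\<^sub>L H = F o\<^sub>L (G o\<^sub>L H)"
  by (rule blinfun_eqI) simp

lemmas op_simps =
  blinfun_compose_assoc
  bounded_bilinear.add_left [OF bounded_bilinear_blinfun_compose]
  bounded_bilinear.add_right [OF bounded_bilinear_blinfun_compose]
  bounded_bilinear.diff_left [OF bounded_bilinear_blinfun_compose]
  bounded_bilinear.diff_right [OF bounded_bilinear_blinfun_compose]
  bounded_bilinear.minus_left [OF bounded_bilinear_blinfun_compose]
  bounded_bilinear.minus_right [OF bounded_bilinear_blinfun_compose]
  bounded_bilinear.scaleR_left [OF bounded_bilinear_blinfun_compose]
  bounded_bilinear.scaleR_right [OF bounded_bilinear_blinfun_compose]

lemma compose_id [simp]: "F o\<^sub>L id_blinfun = F" "id_blinfun o\<^sub>L F = F"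
  by (auto intro: blinfun_eqI)

text \<open>
  The simple tensor of x and c.  On the simple tensors with a fixed x, both actions are
  multiplication in the Clifford algebra, and the simple tensors span the module.  Identities between
  the actions therefore follow from identities in the algebra, without a computation with signs.
\<close>

definition simple_tensor :: "'v::banach \<Rightarrow> cliff \<Rightarrow> 'v cmod" where
  "simple_tensor x c = (\<chi> A. (coeffs c $ A) *\<^sub>R x)"

lemma lact_simple_tensor: "lact a (simple_tensor x c) = simple_tensor x (a * c)"
  by (simp add: lact_def simple_tensor_def times_cliff.rep_eq vec_eq_iff scaleR_sum_left)

lemma ract_simple_tensor: "ract (simple_tensor x c) a = simple_tensor x (c * a)"
  by (simp add: ract_def simple_tensor_def times_cliff.rep_eq vec_eq_iff scaleR_sum_left mult_ac)

lemma simple_tensor_span: "v = (\<Sum>A\<in>UNIV. simple_tensor (v $ A) (Cliff (axis A 1)))"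
  by (simp add: vec_eq_iff simple_tensor_def Cliff_inverse axis_def if_distrib [of "\<lambda>c. c *\<^sub>R _"]
      cong: if_cong)

lemma additive_eqI:
  fixes f g :: "'v::banach cmod \<Rightarrow> 'v cmod"
  assumes "Modules.additive f" "Modules.additive g" "\<And>x c. f (simple_tensor x c) = g (simple_tensor x c)"
  shows "f v = g v"
proof -
  let ?S = "\<Sum>A\<in>UNIV. simple_tensor (v $ A) (Cliff (axis A 1))"
  have "f v = f ?S" by (rule arg_cong [OF simple_tensor_span])
  also have "\<dots> = g ?S"
    by (simp only: Modules.additive.sum [OF assms(1)] Modules.additive.sum [OF assms(2)] assms(3))
  also have "\<dots> = g v" by (rule arg_cong [OF simple_tensor_span [symmetric]])
  finally show ?thesis .
qed

lemma additive_lact: "Modules.additive (lact a)"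
  by standard (simp add: lact_def vec_eq_iff scaleR_add_right sum.distrib)

lemma additive_ract: "Modules.additive (\<lambda>v. ract v a)"
  by standard (simp add: ract_def vec_eq_iff scaleR_add_right sum.distrib)

lemma additive_comp: "Modules.additive f \<Longrightarrow> Modules.additive g \<Longrightarrow> Modules.additive (\<lambda>v. f (g v))"
  by (simp add: Modules.additive_def)

lemma lact_mult: "lact (a * b) v = lact a (lact b v)"
  by (rule additive_eqI [OF additive_lact additive_comp [OF additive_lact additive_lact]])
     (simp add: lact_simple_tensor mult.assoc)

lemma lact_ract: "lact a (ract v b) = ract (lact a v) b"
  by (rule additive_eqI [OF additive_comp [OF additive_lact additive_ract]
        additive_comp [OF additive_ract additive_lact]])
     (simp add: lact_simple_tensor ract_simple_tensor mult.assoc)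

lemma lmul_mult: "lmul (a * b) = lmul a \<odot> lmul b"
  by (rule blinfun_eqI) (simp add: lmul.rep_eq lact_mult)

lemma lmul_add: "lmul (a + b) = lmul a + lmul b"
  by (rule blinfun_eqI)
     (simp add: lmul.rep_eq lact_def plus_cliff.rep_eq blinfun.add_left vec_eq_iff
       algebra_simps sum.distrib)

lemma lmul_scaleR: "lmul (r *\<^sub>R a) = r *\<^sub>R lmul a"
  by (rule blinfun_eqI)
     (simp add: lmul.rep_eq lact_def scaleR_cliff.rep_eq blinfun.scaleR_left vec_eq_iff
       scaleR_sum_right mult_ac)

lemma lmul_diff: "lmul (a - b) = lmul a - lmul b"
  by (simp add: eq_diff_eq flip: lmul_add)

lemma lmul_0: "lmul 0 = 0"
  using lmul_diff [of 0 0] by simp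

lemma lmul_one: "lmul 1 = id_blinfun"
proof (rule blinfun_eqI)
  fix v :: "'a cmod"
  have "lact 1 v = v"
    by (rule additive_eqI [OF additive_lact]) (auto simp: lact_simple_tensor Modules.additive_def)
  then show "blinfun_apply (lmul 1) v = blinfun_apply id_blinfun v"
    by (simp add: lmul.rep_eq)
qed

lemmas lmul_hom = lmul_mult lmul_add lmul_diff lmul_scaleR lmul_one

lemma extend_compose: "extend (F o\<^sub>L G) = extend F \<odot> extend G"
  by (rule blinfun_eqI) (simp add: extend.rep_eq)

lemma extend_add: "extend (F + G) = extend F + extend G"
  by (rule blinfun_eqI) (simp add: extend.rep_eq blinfun.add_left vec_eq_iff)

lemma extend_minus: "extend (- F) = - extend F"
  by (rule blinfun_eqI) (simp add: extend.rep_eq blinfun.minus_left vec_eq_iff)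

lemma extend_sum: "extend (\<Sum>i\<in>S. F i) = (\<Sum>i\<in>S. extend (F i))"
  by (rule Modules.additive.sum) (simp add: Modules.additive_def extend_add)

lemma extend_lmul: "extend F \<odot> lmul a = lmul a \<odot> extend F"
  by (rule blinfun_eqI)
     (simp add: extend.rep_eq lmul.rep_eq lact_def vec_eq_iff blinfun.sum_right blinfun.scaleR_right)

lemma lmul_right_linear: "lmul a \<in> right_linear_ops"
  by (simp add: right_linear_ops_def lmul.rep_eq lact_ract)

lemma extend_right_linear: "extend F \<in> right_linear_ops"
  by (simp add: right_linear_ops_def extend.rep_eq ract_def vec_eq_iff blinfun.sum_right blinfun.scaleR_right)

lemma right_linear_compose:
  "F \<in> right_linear_ops \<Longrightarrow> G \<in> right_linear_ops \<Longrightarrow> F \<odot> G \<in> right_linear_ops"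
  by (simp add: right_linear_ops_def)

lemma right_linear_add:
  "F \<in> right_linear_ops \<Longrightarrow> G \<in> right_linear_ops \<Longrightarrow> F + G \<in> right_linear_ops"
  by (simp add: right_linear_ops_def blinfun.add_left Modules.additive.add [OF additive_ract])

lemma right_linear_diff:
  "F \<in> right_linear_ops \<Longrightarrow> G \<in> right_linear_ops \<Longrightarrow> F - G \<in> right_linear_ops"
  by (simp add: right_linear_ops_def blinfun.diff_left Modules.additive.diff [OF additive_ract])

text \<open>
  The notion of inverse demands right linearity.  It is inherited from F: the element
  (G v) a has the image v a under F, so it is G (v a).
\<close>

lemma right_linear_inverse:
  assumes "F \<in> right_linear_ops" "F \<odot> G = id_blinfun" "G \<odot> F = id_blinfun"
  shows "G \<in> right_linear_ops"
proof -
  have FG: "blinfun_apply F (blinfun_apply G v) = v" for v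
    using arg_cong [OF assms(2), of "\<lambda>H. blinfun_apply H v"] by simp
  have GF: "blinfun_apply G (blinfun_apply F v) = v" for v
    using arg_cong [OF assms(3), of "\<lambda>H. blinfun_apply H v"] by simp
  have "blinfun_apply G (ract v a) = ract (blinfun_apply G v) a" for v a
  proof -
    have "blinfun_apply F (ract (blinfun_apply G v) a) = ract v a"
      using assms(1) by (simp add: right_linear_ops_def FG)
    then show ?thesis using GF [of "ract (blinfun_apply G v) a"] by simp
  qed
  then show ?thesis by (simp add: right_linear_ops_def)
qed

lemma op_inverse_eq:
  assumes "is_op_inverse F G"
  shows "op_inverse F = G"
  unfolding op_inverse_def
proof (rule the_equality)
  fix H assume H: "is_op_inverse F H"
  have "H = (G \<odot> F) \<odot> H" using assms by (simp add: is_op_inverse_def)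
  also have "\<dots> = G \<odot> (F \<odot> H)" by (rule blinfun_compose_assoc)
  also have "\<dots> = G" using H by (simp add: is_op_inverse_def)
  finally show "H = G" .
qed fact

text \<open>
  The main (grade) involution e_A \<mapsto> (-1)^|A| e_A, carried over to the module.
\<close>

lift_definition grade :: "'v::banach cop" is "\<lambda>v. \<chi> A. (-1) ^ card A *\<^sub>R (v $ A)"
  by (rule bounded_linear_vec_lambda, rule bounded_linear_const_scaleR, rule bounded_linear_vec_nth)

lemma grade_grade: "grade \<odot> grade = id_blinfun"
  by (rule blinfun_eqI) (simp add: grade.rep_eq vec_eq_iff flip: power_add mult_2)

lemma grade_extend: "grade \<odot> extend F = extend F \<odot> grade"
  by (rule blinfun_eqI) (simp add: grade.rep_eq extend.rep_eq vec_eq_iff blinfun.scaleR_right)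

lemma grade_cliff_e: "grade \<odot> lmul (cliff_e j) = - (lmul (cliff_e j) \<odot> grade)"
proof (rule blinfun_eqI)
  fix v :: "'a cmod"
  have e: "lact (cliff_e j) v $ C = blade_sign {j} (sym_diff {j} C) *\<^sub>R v $ sym_diff {j} C" for v :: "'a cmod" and C
  proof -
    have "lact (cliff_e j) v $ C
       = (\<Sum>A\<in>UNIV. if A = {j} then blade_sign {j} (sym_diff {j} C) *\<^sub>R v $ sym_diff {j} C else 0)"
      by (simp only: lact_def vec_lambda_beta, rule sum.cong) (auto simp: cliff_e_coeff)
    then show ?thesis by simp
  qed
  have sgn: "(-1 :: real) ^ card (sym_diff {j} C) = - ((-1) ^ card C)" for C
    using prod_sym_diff [of "\<lambda>_. -1" "{j}" C] by simp
  show "blinfun_apply (grade \<odot> lmul (cliff_e j)) v = blinfun_apply (- (lmul (cliff_e j) \<odot> grade)) v"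
    by (simp only: blinfun_apply_blinfun_compose blinfun.minus_left lmul.rep_eq grade.rep_eq e
         vec_eq_iff vec_lambda_beta vector_uminus_component sgn) (simp add: mult_ac)
qed

text \<open>
  Conjugation by the involution changes the sign of every unit e_j and leaves the components alone.
  Hence an identity or an inverse for T yields one for its conjugate.
\<close>

lemma grade_para_op:
  "grade \<odot> para_op T0 T \<odot> grade = para_op T0 (\<lambda>j. - T j)"
proof -
  have "grade \<odot> (lmul (cliff_e j) \<odot> extend F) \<odot> grade = - (lmul (cliff_e j) \<odot> extend F)" for j and F :: "'a \<Rightarrow>\<^sub>L 'a"
  proof -
    have "grade \<odot> (lmul (cliff_e j) \<odot> extend F) \<odot> grade = (grade \<odot> lmul (cliff_e j)) \<odot> (extend F \<odot> grade)"
      by (simp add: blinfun_compose_assoc)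
    also have "\<dots> = - (lmul (cliff_e j) \<odot> (grade \<odot> grade) \<odot> extend F)"
      by (simp add: grade_cliff_e op_simps flip: grade_extend)
    finally show ?thesis by (simp add: grade_grade)
  qed
  moreover have "grade \<odot> extend F \<odot> grade = extend F" for F :: "'a \<Rightarrow>\<^sub>L 'a"
    by (simp add: grade_extend blinfun_compose_assoc grade_grade)
  ultimately show ?thesis
    by (simp add: para_op_def op_simps extend_minus sum_negf
       bounded_bilinear.sum_left [OF bounded_bilinear_blinfun_compose]
       bounded_bilinear.sum_right [OF bounded_bilinear_blinfun_compose])
qed

section \<open>Operators with commuting components\<close>

lemma compose_left_commute:
  "F o\<^sub>L G = G o\<^sub>L F \<Longrightarrow> F o\<^sub>L (G o\<^sub>L H) = G o\<^sub>L (F o\<^sub>L H)"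
  by (simp flip: blinfun_compose_assoc)

text \<open>
  Let X be the vector part of T.  The components commute, so X commutes with the scalar part and
  its square has no mixed products of units.  Hence the trace T + cnj T and the norm T (cnj T) are
  componentwise operators.
\<close>

lemma BC01_components:
  assumes "T \<in> BC01"
  obtains T0 N where
    "T + op_cnj T = extend T0" "T \<odot> op_cnj T = extend N" "op_cnj T \<odot> T = extend N"
    "T0 o\<^sub>L N = N o\<^sub>L T0"
proof -
  obtain T0 Tj where T: "T = para_op T0 Tj"
    and comm0: "\<And>j. T0 o\<^sub>L Tj j = Tj j o\<^sub>L T0"
    and comm: "\<And>j k. Tj j o\<^sub>L Tj k = Tj k o\<^sub>L Tj j"
    using assms by (auto simp: BC01_def)
  define X where "X = (\<Sum>j\<in>UNIV. lmul (cliff_e j) \<odot> extend (Tj j))"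
  have T': "T = extend T0 + X" by (simp add: T para_op_def X_def)
  have U': "op_cnj T = extend T0 - X"
    unfolding T op_cnj_para_op by (simp add: para_op_def X_def extend_minus op_simps sum_negf)
  note sum_left = bounded_bilinear.sum_left [OF bounded_bilinear_blinfun_compose]
  note sum_right = bounded_bilinear.sum_right [OF bounded_bilinear_blinfun_compose]
  have TX: "extend T0 \<odot> X = X \<odot> extend T0"
  proof -
    have "extend T0 \<odot> (lmul (cliff_e j) \<odot> extend (Tj j))
        = (lmul (cliff_e j) \<odot> extend (Tj j)) \<odot> extend T0" for j
      by (simp add: compose_left_commute [OF extend_lmul] blinfun_compose_assoc comm0
          flip: extend_compose)
    then show ?thesis by (simp add: X_def sum_left sum_right)
  qed
  have swap: "(lmul a \<odot> extend F) \<odot> (lmul b \<odot> extend G) = lmul (a * b) \<odot> extend (F o\<^sub>L G)"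
    for a b and F G :: "'a \<Rightarrow>\<^sub>L 'a"
    by (simp add: blinfun_compose_assoc compose_left_commute [OF extend_lmul] lmul_mult extend_compose)
  have "X \<odot> X = (\<Sum>j\<in>UNIV. \<Sum>k\<in>UNIV. lmul (cliff_e j * cliff_e k) \<odot> extend (Tj j o\<^sub>L Tj k))"
    unfolding X_def sum_left unfolding sum_right swap ..
  also have "\<dots> = (\<Sum>j\<in>UNIV. lmul (cliff_e j * cliff_e j) \<odot> extend (Tj j o\<^sub>L Tj j))"
  proof (rule sum_antisymmetric_off_diagonal)
    fix j k :: 5
    assume "j \<noteq> k"
    then show "lmul (cliff_e j * cliff_e k) \<odot> extend (Tj j o\<^sub>L Tj k)
        + lmul (cliff_e k * cliff_e j) \<odot> extend (Tj k o\<^sub>L Tj j) = 0"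
      using cliff_e_anticommute [of j k]
      by (simp add: lmul_0 comm [of j k] flip: lmul_add bounded_bilinear.add_left [OF bounded_bilinear_blinfun_compose])
  qed
  also have "\<dots> = - extend (\<Sum>j\<in>UNIV. Tj j o\<^sub>L Tj j)"
    using lmul_scaleR [of "-1" 1, where 'a = 'a]
    by (simp add: cliff_e_square lmul_one extend_sum sum_negf op_simps)
  finally have XX: "X \<odot> X = - extend (\<Sum>j\<in>UNIV. Tj j o\<^sub>L Tj j)" .
  show thesis
  proof
    show "T + op_cnj T = extend (T0 + T0)"
      unfolding U' by (simp add: T' extend_add)
    show "T \<odot> op_cnj T = extend ((T0 o\<^sub>L T0) + (\<Sum>j\<in>UNIV. Tj j o\<^sub>L Tj j))"
      "op_cnj T \<odot> T = extend ((T0 o\<^sub>L T0) + (\<Sum>j\<in>UNIV. Tj j o\<^sub>L Tj j))"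
      unfolding U' by (simp_all add: T' op_simps TX XX extend_add extend_compose)
    show "(T0 + T0) o\<^sub>L ((T0 o\<^sub>L T0) + (\<Sum>j\<in>UNIV. Tj j o\<^sub>L Tj j))
        = ((T0 o\<^sub>L T0) + (\<Sum>j\<in>UNIV. Tj j o\<^sub>L Tj j)) o\<^sub>L (T0 + T0)"
      by (simp add: op_simps sum_left sum_right comm0 compose_left_commute [OF comm0] sum.distrib)
  qed
qed

lemma op_cnj_op_cnj: "T \<in> BC01 \<Longrightarrow> op_cnj (op_cnj T) = T"
  by (auto simp: BC01_def op_cnj_para_op)

lemma op_cnj_eq_grade: "T \<in> BC01 \<Longrightarrow> op_cnj T = grade \<odot> T \<odot> grade"
  by (auto simp: BC01_def op_cnj_para_op grade_para_op)

text \<open>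
  Both sides are (s - T) (cnj s - T) (s - U) (cnj s - U) written as if all factors commuted, grouped
  by operator on the left and by paravector on the right.  Since s and T need not commute, the proof
  does not use these factors but expresses both sides by the trace and the norm.
\<close>

lemma product_of_conjugate_polynomials:
  fixes T U :: "'v::banach cop"
  assumes s: "s \<in> paravectors"
    and t: "T + U = extend T0" and n: "T \<odot> U = extend N" "U \<odot> T = extend N"
    and comm: "T0 o\<^sub>L N = N o\<^sub>L T0"
  shows "(T \<odot> T - (2 * Re_c s) *\<^sub>R T + (abs_c s)\<^sup>2 *\<^sub>R id_blinfun)
       \<odot> (U \<odot> U - (2 * Re_c s) *\<^sub>R U + (abs_c s)\<^sup>2 *\<^sub>R id_blinfun)
      = (lmul (s * s) - lmul s \<odot> extend T0 + extend N)
        \<odot> (lmul (cnj_c s * cnj_c s) - lmul (cnj_c s) \<odot> extend T0 + extend N)"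
proof -
  define c where "c = 2 * Re_c s"
  define d where "d = (abs_c s)\<^sup>2"
  have c: "cnj_c s = c *\<^sub>R 1 - s"
    using paravector_times_cnj(3) [OF s] by (simp add: c_def of_real_def algebra_simps)
  have ss: "s * s = c *\<^sub>R s - d *\<^sub>R 1"
    using paravector_times_cnj(1) [OF s] unfolding c by (simp add: d_def algebra_simps of_real_def)
  have ll: "lmul s \<odot> lmul s = c *\<^sub>R lmul s - d *\<^sub>R id_blinfun"
    by (simp add: ss lmul_hom flip: lmul_mult)
  have ll': "lmul s \<odot> (lmul s \<odot> F) = c *\<^sub>R (lmul s \<odot> F) - d *\<^sub>R F" for F :: "'v cop"
    by (simp add: ll op_simps flip: blinfun_compose_assoc)
  have comm': "extend N \<odot> extend T0 = extend T0 \<odot> extend N"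
    by (simp add: comm flip: extend_compose)
  have TU: "T \<odot> U = U \<odot> T" using n by simp
  have "(T \<odot> T - c *\<^sub>R T + d *\<^sub>R id_blinfun) \<odot> (U \<odot> U - c *\<^sub>R U + d *\<^sub>R id_blinfun)
      = (T \<odot> U) \<odot> (T \<odot> U) - c *\<^sub>R ((T \<odot> U) \<odot> (T + U))
        + d *\<^sub>R ((T + U) \<odot> (T + U) - 2 *\<^sub>R (T \<odot> U))
        + (c * c) *\<^sub>R (T \<odot> U) - (c * d) *\<^sub>R (T + U) + (d * d) *\<^sub>R id_blinfun"
    by (simp add: op_simps TU compose_left_commute [OF TU] algebra_simps scaleR_2)
  also have "\<dots> = extend N \<odot> extend N - c *\<^sub>R (extend N \<odot> extend T0)
        + d *\<^sub>R (extend T0 \<odot> extend T0 - 2 *\<^sub>R extend N)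
        + (c * c) *\<^sub>R extend N - (c * d) *\<^sub>R extend T0 + (d * d) *\<^sub>R id_blinfun"
    by (simp only: t n)
  also have "\<dots> = (lmul (s * s) - lmul s \<odot> extend T0 + extend N)
        \<odot> (lmul (cnj_c s * cnj_c s) - lmul (cnj_c s) \<odot> extend T0 + extend N)"
    unfolding c
    by (simp add: lmul_hom op_simps ll ll' extend_lmul comm' compose_left_commute [OF extend_lmul]
        compose_left_commute [OF comm'] algebra_simps scaleR_2)
  finally show ?thesis unfolding c_def d_def .
qed

text \<open>
  With P the real quadratic polynomial of s and R = Q(cnj s), the product Q R = P(T) P(cnj T) is
  invertible, and Q and R commute; so Q has a left and a right inverse.
\<close>

lemma Qc_inverse:
  fixes T :: "'v::banach cop"
  assumes T: "T \<in> BC01" and s: "s \<in> S_resolvent_set T"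
    and t: "T + op_cnj T = extend T0" and n: "T \<odot> op_cnj T = extend N" "op_cnj T \<odot> T = extend N"
    and comm: "T0 o\<^sub>L N = N o\<^sub>L T0"
  defines "Q \<equiv> lmul (s * s) - lmul s \<odot> extend T0 + extend N"
  shows "Q \<odot> Qc_inv s T = id_blinfun" "Qc_inv s T \<odot> Q = id_blinfun"
proof -
  have sp: "s \<in> paravectors" using s by (simp add: S_resolvent_set_def)
  define P where "P F = F \<odot> F - (2 * Re_c s) *\<^sub>R F + (abs_c s)\<^sup>2 *\<^sub>R id_blinfun" for F :: "'v cop"
  obtain G where PG: "P T \<odot> G = id_blinfun" and GP: "G \<odot> P T = id_blinfun"
    using s by (auto simp: S_resolvent_set_def S_spectrum_def op_invertible_def is_op_inverse_def P_def)
  define H where "H = grade \<odot> G \<odot> grade"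
  have gg: "grade \<odot> (grade \<odot> F) = F" for F :: "'v cop"
    by (simp add: grade_grade flip: blinfun_compose_assoc)
  (* The involution carries the inverse G of P(T) to the inverse H of P(cnj T). *)
  have PU: "P (op_cnj T) = grade \<odot> P T \<odot> grade"
    by (simp add: op_cnj_eq_grade [OF T] P_def op_simps gg grade_grade)
  have PG': "P T \<odot> (G \<odot> F) = F" "G \<odot> (P T \<odot> F) = F" for F
    by (simp_all add: PG GP flip: blinfun_compose_assoc)
  have PH: "P (op_cnj T) \<odot> H = id_blinfun" and HP: "H \<odot> P (op_cnj T) = id_blinfun"
    by (simp_all add: PU H_def blinfun_compose_assoc gg PG' grade_grade)
  define R where "R = lmul (cnj_c s * cnj_c s) - lmul (cnj_c s) \<odot> extend T0 + extend N"
  have prod: "P T \<odot> P (op_cnj T) = Q \<odot> R"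
    unfolding P_def Q_def R_def
    by (rule product_of_conjugate_polynomials [OF sp t n comm])
  have comm': "extend N \<odot> extend T0 = extend T0 \<odot> extend N"
    by (simp add: comm flip: extend_compose)
  have css: "cnj_c s * s = s * cnj_c s"
    using paravector_times_cnj [OF sp] by simp
  have "lmul (cnj_c s) \<odot> lmul s = lmul s \<odot> lmul (cnj_c s)"
    by (simp add: css flip: lmul_mult)
  note c = this compose_left_commute [OF this]
  have "R \<odot> Q = Q \<odot> R"
    unfolding R_def Q_def
    by (simp add: lmul_mult op_simps c extend_lmul comm' compose_left_commute [OF extend_lmul]
        compose_left_commute [OF comm'] algebra_simps)
  have "Q \<odot> (R \<odot> (H \<odot> G)) = (P T \<odot> P (op_cnj T)) \<odot> (H \<odot> G)"
    by (simp add: prod blinfun_compose_assoc)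
  also have "\<dots> = P T \<odot> ((P (op_cnj T) \<odot> H) \<odot> G)"
    by (simp only: blinfun_compose_assoc)
  finally have right: "Q \<odot> (R \<odot> (H \<odot> G)) = id_blinfun" by (simp add: PH PG)
  have "((H \<odot> G) \<odot> R) \<odot> Q = (H \<odot> G) \<odot> (P T \<odot> P (op_cnj T))"
    by (simp add: prod blinfun_compose_assoc \<open>R \<odot> Q = Q \<odot> R\<close>)
  also have "\<dots> = H \<odot> ((G \<odot> P T) \<odot> P (op_cnj T))"
    by (simp only: blinfun_compose_assoc)
  finally have left: "((H \<odot> G) \<odot> R) \<odot> Q = id_blinfun" by (simp add: GP HP)
  have "(H \<odot> G) \<odot> R = ((H \<odot> G) \<odot> R) \<odot> (Q \<odot> (R \<odot> (H \<odot> G)))"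
    by (simp add: right)
  also have "\<dots> = (((H \<odot> G) \<odot> R) \<odot> Q) \<odot> (R \<odot> (H \<odot> G))"
    by (simp only: blinfun_compose_assoc)
  finally have "(H \<odot> G) \<odot> R = R \<odot> (H \<odot> G)" by (simp add: left)
  with left have left': "(R \<odot> (H \<odot> G)) \<odot> Q = id_blinfun" by simp
  have "Q \<in> right_linear_ops"
    unfolding Q_def
    by (intro right_linear_add right_linear_diff right_linear_compose lmul_right_linear extend_right_linear)
  then have inv: "is_op_inverse Q (R \<odot> (H \<odot> G))"
    using right left' right_linear_inverse by (auto simp: is_op_inverse_def)
  have "Qc_inv s T = op_inverse Q"
    by (simp add: Qc_inv_def Q_def t n power2_eq_square)
  with inv have "is_op_inverse Q (Qc_inv s T)"
    by (simp add: op_inverse_eq)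
  then show "Q \<odot> Qc_inv s T = id_blinfun" "Qc_inv s T \<odot> Q = id_blinfun"
    by (simp_all add: is_op_inverse_def)
qed

lemma inverse_commute:
  fixes F A A' :: "'a::real_normed_vector \<Rightarrow>\<^sub>L 'a"
  assumes "A o\<^sub>L A' = id_blinfun" "A' o\<^sub>L A = id_blinfun" "F o\<^sub>L A' = A' o\<^sub>L F"
  shows "F o\<^sub>L A = A o\<^sub>L F"
proof -
  have "A o\<^sub>L F = A o\<^sub>L (F o\<^sub>L A') o\<^sub>L A"
    by (simp add: blinfun_compose_assoc assms(2))
  also have "\<dots> = (A o\<^sub>L A') o\<^sub>L (F o\<^sub>L A)"
    by (simp only: assms(3) blinfun_compose_assoc)
  finally show ?thesis by (simp add: assms(1))
qed

text \<open>
  Multiplying the hypothesis on M by A on the left and by B on the right gives the kernel equation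
  A M B q = (A - B) p - c (A - B).  Multiplied by B on the right and by A on the left, its mixed
  terms A B p and c A B appear with opposite signs and cancel in the sum.
\<close>

lemma resolvent_equation_of_commuting_inverses:
  fixes A A' B B' M p q r c :: "'v::banach cop"
  assumes A: "A \<odot> A' = id_blinfun" "A' \<odot> A = id_blinfun"
    and B: "B \<odot> B' = id_blinfun" "B' \<odot> B = id_blinfun"
    and r: "q \<odot> r = id_blinfun"
    and c: "c \<odot> A' = A' \<odot> c" and p: "p \<odot> B' = B' \<odot> p" and q: "q \<odot> B' = B' \<odot> q"
    and M: "M \<odot> q = (B' - A') \<odot> p - c \<odot> (B' - A')"
  shows "A \<odot> M \<odot> B \<odot> B + A \<odot> A \<odot> M \<odot> B
       = ((A \<odot> A - B \<odot> B) \<odot> p - c \<odot> (A \<odot> A - B \<odot> B)) \<odot> r"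
proof -
  note cA = inverse_commute [OF A c] and pB = inverse_commute [OF B p] and qB = inverse_commute [OF B q]
  have cancel: "A \<odot> (A' \<odot> F) = F" "B' \<odot> (B \<odot> F) = F" for F
    by (simp_all add: A B flip: blinfun_compose_assoc)
  have cA'': "c \<odot> (A' \<odot> F) = A' \<odot> (c \<odot> F)" for F
    by (simp add: c flip: blinfun_compose_assoc)
  have cA': "c \<odot> (A \<odot> F) = A \<odot> (c \<odot> F)" and pB': "p \<odot> (B \<odot> F) = B \<odot> (p \<odot> F)" for F
    by (simp_all add: cA pB flip: blinfun_compose_assoc)
  have "A \<odot> (M \<odot> (B \<odot> q)) = A \<odot> ((M \<odot> q) \<odot> B)"
    by (simp add: qB blinfun_compose_assoc)
  also have "\<dots> = (A - B) \<odot> p - c \<odot> (A - B)"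
    by (simp add: M op_simps cancel cA cA'' pB pB' B)
  finally have key: "A \<odot> (M \<odot> (B \<odot> q)) = (A - B) \<odot> p - c \<odot> (A - B)" .
  have "(A \<odot> M \<odot> B \<odot> B + A \<odot> A \<odot> M \<odot> B) \<odot> q
      = (A \<odot> (M \<odot> (B \<odot> q))) \<odot> B + A \<odot> (A \<odot> (M \<odot> (B \<odot> q)))"
    by (simp add: op_simps qB)
  also have "\<dots> = (A \<odot> A - B \<odot> B) \<odot> p - c \<odot> (A \<odot> A - B \<odot> B)"
    by (simp add: key op_simps pB pB' cA cA')
  finally have "(A \<odot> M \<odot> B \<odot> B + A \<odot> A \<odot> M \<odot> B) \<odot> q \<odot> r
      = ((A \<odot> A - B \<odot> B) \<odot> p - c \<odot> (A \<odot> A - B \<odot> B)) \<odot> r"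
    by simp
  then show ?thesis by (simp add: blinfun_compose_assoc r)
qed

theorem theorem4p5:
  fixes T :: "'v::banach cop" and p s :: cliff
  assumes "T \<in> BC01"
    and "p \<in> S_resolvent_set T" and "s \<in> S_resolvent_set T"
    and "s \<notin> class_c p"
  shows "S_R s (op_cnj T) \<odot> S_DDelta_L p T + S_DDelta_R s T \<odot> S_L p (op_cnj T)
       + (1/2) *\<^sub>R (S_D_R s T \<odot> S_Delta_L p T) + (1/2) *\<^sub>R (S_Delta_R s T \<odot> S_D_L p T)
     = ((S_DDelta_L s T - S_DDelta_R p T) \<odot> lmul p
        - lmul (cnj_c s) \<odot> (S_DDelta_L s T - S_DDelta_R p T)) \<odot> lmul (Q_poly_inv s p)
    \<and> S_R s T \<odot> S_DDelta_L p T + S_DDelta_R s T \<odot> S_L p T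
       + (1/2) *\<^sub>R (S_D_R s T \<odot> S_Delta_L p (op_cnj T)) + (1/2) *\<^sub>R (S_Delta_R s (op_cnj T) \<odot> S_D_L p T)
     = ((S_DDelta_L s T - S_DDelta_R p T) \<odot> lmul p
        - lmul (cnj_c s) \<odot> (S_DDelta_L s T - S_DDelta_R p T)) \<odot> lmul (Q_poly_inv s p)"
proof -
  obtain T0 N where t: "T + op_cnj T = extend T0"
    and n: "T \<odot> op_cnj T = extend N" "op_cnj T \<odot> T = extend N"
    and comm: "T0 o\<^sub>L N = N o\<^sub>L T0"
    using BC01_components [OF assms(1)] .
  have ps: "p \<in> paravectors" "s \<in> paravectors"
    using assms by (simp_all add: S_resolvent_set_def)
  define A where "A = Qc_inv s T"
  define B where "B = Qc_inv p T"
  define A' where "A' = lmul (s * s) - lmul s \<odot> extend T0 + extend N"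
  define B' where "B' = lmul (p * p) - lmul p \<odot> extend T0 + extend N"
  define M where "M = lmul (s + p) - extend T0"
  have A: "A \<odot> A' = id_blinfun" "A' \<odot> A = id_blinfun"
    unfolding A_def A'_def by (rule Qc_inverse [OF assms(1,3) t n comm])+
  have B: "B \<odot> B' = id_blinfun" "B' \<odot> B = id_blinfun"
    unfolding B_def B'_def by (rule Qc_inverse [OF assms(1,2) t n comm])+
  have commute: "lmul a \<odot> (lmul (b * b) - lmul b \<odot> extend T0 + extend N)
      = (lmul (b * b) - lmul b \<odot> extend T0 + extend N) \<odot> lmul a" if "a * b = b * a" for a b
  proof -
    have ab: "lmul a \<odot> lmul b = (lmul b \<odot> lmul a :: 'v cop)"
      by (simp add: that flip: lmul_mult)
    show ?thesis
      by (simp add: lmul_mult op_simps extend_lmul ab compose_left_commute [OF ab])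
  qed
  have "A \<odot> M \<odot> B \<odot> B + A \<odot> A \<odot> M \<odot> B
      = ((A \<odot> A - B \<odot> B) \<odot> lmul p - lmul (cnj_c s) \<odot> (A \<odot> A - B \<odot> B)) \<odot> lmul (Q_poly_inv s p)"
  proof (rule resolvent_equation_of_commuting_inverses [OF A B])
    show "lmul (Q_poly s p) \<odot> lmul (Q_poly_inv s p) = id_blinfun"
      by (simp add: Q_poly_invertible [OF ps assms(4)] lmul_one flip: lmul_mult)
    show "lmul (cnj_c s) \<odot> A' = A' \<odot> lmul (cnj_c s)"
      unfolding A'_def by (rule commute) (simp add: paravector_times_cnj [OF ps(2)])
    show "lmul p \<odot> B' = B' \<odot> lmul p"
      unfolding B'_def by (rule commute) simp
    show "lmul (Q_poly s p) \<odot> B' = B' \<odot> lmul (Q_poly s p)"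
      unfolding B'_def by (rule commute) (simp add: Q_poly_alt algebra_simps)
    show "M \<odot> lmul (Q_poly s p) = (B' - A') \<odot> lmul p - lmul (cnj_c s) \<odot> (B' - A')"
    proof -
      have "B' - A' = lmul (p * p - s * s) - lmul (p - s) \<odot> extend T0"
        by (simp add: B'_def A'_def lmul_diff op_simps)
      then have "(B' - A') \<odot> lmul p - lmul (cnj_c s) \<odot> (B' - A')
          = lmul ((p * p - s * s) * p - cnj_c s * (p * p - s * s))
            - lmul ((p - s) * p - cnj_c s * (p - s)) \<odot> extend T0"
        by (simp add: op_simps extend_lmul lmul_diff [of "x * y" for x y] lmul_mult)
      also have "\<dots> = M \<odot> lmul (Q_poly s p)"
        by (simp only: Q_poly_kernel_identity [OF ps(2)] M_def lmul_mult op_simps extend_lmul)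
      finally show ?thesis ..
    qed
  qed
  then have main: "16 *\<^sub>R (A \<odot> M \<odot> B \<odot> B + A \<odot> A \<odot> M \<odot> B)
      = ((S_DDelta_L s T - S_DDelta_R p T) \<odot> lmul p
        - lmul (cnj_c s) \<odot> (S_DDelta_L s T - S_DDelta_R p T)) \<odot> lmul (Q_poly_inv s p)"
    by (simp add: S_DDelta_L_def S_DDelta_R_def Qc_inv2_def A_def B_def op_simps
        flip: scaleR_diff_right)
  (* Conjugation of T changes neither trace nor norm, so all kernels share the inverses A and B. *)
  have Qc: "Qc_inv x (op_cnj T) = Qc_inv x T" for x
    by (simp add: Qc_inv_def op_cnj_op_cnj [OF assms(1)] n add.commute)
  have M: "M = lmul s + lmul p - T - op_cnj T"
    by (simp add: M_def lmul_add flip: t)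
  note kernels = S_R_def S_L_def S_DDelta_L_def S_DDelta_R_def S_D_R_def S_D_L_def S_Delta_L_def
    S_Delta_R_def Qc_inv2_def Qc op_cnj_op_cnj [OF assms(1)]
  show ?thesis
    unfolding main [symmetric] unfolding kernels A_def [symmetric] B_def [symmetric] M
    by (simp add: op_simps algebra_simps)
qed

end
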